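(* Let $(X,T)$ be a $\mathbb{G}$-TDS and let $f\in C(X)$. (a) If $(X,T)$ is transitive, then exactly one of the following holds: $(X,T)$ is $f$-almost mean equicontinuous, or $(X,T)$ is $f$-mean sensitive. (b) If $(X,T)$ is minimal, then exactly one of the following holds: $(X,T)$ is $f$-mean equicontinuous, or $(X,T)$ is $f$-mean sensitive.
   Context: $\mathbb{G}$ is a locally compact abelian group (written additively, identity $e$) with Haar measure $\nu$, and $(F_n)_{n\in\mathbb{N}}$ is a fixed Følner sequence in $\mathbb{G}$: measurable sets with $0<\nu(F_n)<\infty$ and $\nu((g+F_n)\triangle F_n)/\nu(F_n)\to 0$ for every $g\in\mathbb{G}$; it is moreover chosen to satisfy the pointwise ergodic theorem (for every ergodic measure preserving $\mathbb{G}$-action on a standard probability space $(Y,m)$ and every $h\in L^1(Y,m)$, $\frac{1}{\nu(F_n)}\int_{F_n}h(T^jy)\,d\nu(j)\to\int h\,dm$ for $m$-a.e. $y$). A $\mathbb{G}$-TDS is a pair $(X,T)$ with $X$ a (nonempty) compact metric space (metric $d$) and $T:\mathbb{G}\times X\to X$, $(j,x)\mapsto T^jx$, a group action (jointly Borel measurable) with each $T^j:X\to X$ continuous. $C(X)$ is the space of continuous complex-valued functions on $X$. A point $x$ is transitive if $\{T^ix:i\in\mathbb{G}\}$ is dense in $X$. $(X,T)$ is transitive if $X$ contains a residual set of transitive points, and minimal if every point is transitive. For $f\in C(X)$ define $d_f(x,y)=\limsup_n\left(\frac{1}{\nu(F_n)}\int_{F_n}|f(T^jx)-f(T^jy)|^2d\nu(j)\right)^{1/2}$.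 $(X,T)$ is $f$-mean sensitive if there is $\varepsilon>0$ such that every nonempty open $U\subset X$ contains $x,y$ with $d_f(x,y)>\varepsilon$. A point $x\in X$ is an $f$-mean equicontinuity point if for every $\varepsilon>0$ there is $\delta>0$ such that $d(x,y)\le\delta$ implies $d_f(x,y)\le\varepsilon$. $(X,T)$ is $f$-mean equicontinuous if every $x\in X$ is an $f$-mean equicontinuity point, and $f$-almost mean equicontinuous if the set of $f$-mean equicontinuity points is residual. *)

theory Defs
  imports "HOL-Analysis.Analysis"
begin

section \<open>Haar measure\<close>

definition haar_measure :: "'g::{topological_ab_group_add, t2_space} measure \<Rightarrow> bool" where
  "haar_measure \<nu> \<longleftrightarrow>
     sets \<nu> = sets borel \<and>
     emeasure \<nu> UNIV \<noteq> 0 \<and>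
     (\<forall>g. \<forall>A\<in>sets \<nu>. emeasure \<nu> ((+) g ` A) = emeasure \<nu> A) \<and>
     (\<forall>K. compact K \<longrightarrow> emeasure \<nu> K < \<infinity>) \<and>
     (\<forall>A\<in>sets \<nu>. emeasure \<nu> A = (INF U\<in>{U. open U \<and> A \<subseteq> U}. emeasure \<nu> U)) \<and>
     (\<forall>U. open U \<longrightarrow> emeasure \<nu> U = (SUP K\<in>{K. compact K \<and> K \<subseteq> U}. emeasure \<nu> K))"


section \<open>Folner sequences and the pointwise ergodic theorem\<close>

definition folner_sequence ::
  "'g::{topological_ab_group_add, t2_space} measure \<Rightarrow> (nat \<Rightarrow> 'g set) \<Rightarrow> bool" where
  "folner_sequence \<nu> F \<longleftrightarrow>
     (\<forall>n. F n \<in> sets \<nu> \<and> 0 < emeasure \<nu> (F n) \<and> emeasure \<nu> (F n) < \<infinity>) \<and>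
     (\<forall>g. (\<lambda>n. measure \<nu> (sym_diff ((+) g ` F n) (F n)) / measure \<nu> (F n)) \<longlonglongrightarrow> 0)"

definition set_average ::
  "'g measure \<Rightarrow> 'g set \<Rightarrow> ('g \<Rightarrow> 'b::{banach, second_countable_topology}) \<Rightarrow> 'b" where
  "set_average \<nu> A \<phi> = (LINT j:A|\<nu>. \<phi> j) /\<^sub>R measure \<nu> A"

definition standard_prob_space :: "'y measure \<Rightarrow> bool" where
  "standard_prob_space m \<longleftrightarrow>
     emeasure m (space m) = 1 \<and>
     (\<exists>\<tau>. completely_metrizable_space \<tau> \<and> second_countable \<tau> \<and>
          topspace \<tau> = space m \<and> sets m = sigma_sets (topspace \<tau>) {U. openin \<tau> U})"

definition measure_preserving_action ::
  "'y measure \<Rightarrow> ('g::{topological_ab_group_add, t2_space} \<Rightarrow> 'y \<Rightarrow> 'y) \<Rightarrow> bool" where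
  "measure_preserving_action m T \<longleftrightarrow>
     (\<lambda>(j, y). T j y) \<in> measurable (borel \<Otimes>\<^sub>M m) m \<and>
     (\<forall>y\<in>space m. T 0 y = y) \<and>
     (\<forall>i j. \<forall>y\<in>space m. T (i + j) y = T i (T j y)) \<and>
     (\<forall>j. \<forall>A\<in>sets m. emeasure m (T j -` A \<inter> space m) = emeasure m A)"

definition ergodic_action ::
  "'y measure \<Rightarrow> ('g::{topological_ab_group_add, t2_space} \<Rightarrow> 'y \<Rightarrow> 'y) \<Rightarrow> bool" where
  "ergodic_action m T \<longleftrightarrow>
     measure_preserving_action m T \<and>
     (\<forall>A\<in>sets m. (\<forall>j. emeasure m (sym_diff (T j -` A \<inter> space m) A) = 0) \<longrightarrow>
        emeasure m A = 0 \<or> emeasure m A = 1)"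

text \<open>
  Every standard Borel space is Borel isomorphic to one whose underlying set is a set of real
  numbers, so quantifying over measures carried by subsets of the reals (with an arbitrary Polish
  topology generating their measurable sets) covers all standard probability spaces.
\<close>

definition pointwise_ergodic_sequence ::
  "'g::{topological_ab_group_add, t2_space} measure \<Rightarrow> (nat \<Rightarrow> 'g set) \<Rightarrow> bool" where
  "pointwise_ergodic_sequence \<nu> F \<longleftrightarrow>
     (\<forall>(m::real measure) (T::'g \<Rightarrow> real \<Rightarrow> real) (h::real \<Rightarrow> complex).
        standard_prob_space m \<and> ergodic_action m T \<and> integrable m h \<longrightarrow>
        (AE y in m. (\<lambda>n. set_average \<nu> (F n) (\<lambda>j. h (T j y))) \<longlonglongrightarrow> (LINT y|m. h y)))"


section \<open>Topological dynamical systems\<close>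

text \<open>The phase space is the whole (automatically nonempty) type \<open>'x\<close>.\<close>

definition TDS ::
  "('g::{topological_ab_group_add, t2_space} \<Rightarrow> 'x::metric_space \<Rightarrow> 'x) \<Rightarrow> bool" where
  "TDS T \<longleftrightarrow>
     compact (UNIV :: 'x set) \<and>
     (\<forall>x. T 0 x = x) \<and>
     (\<forall>i j x. T (i + j) x = T i (T j x)) \<and>
     (\<lambda>(j, x). T j x) \<in> borel_measurable borel \<and>
     (\<forall>j. continuous_on UNIV (T j))"

definition residual :: "'x::topological_space set \<Rightarrow> bool" where
  "residual R \<longleftrightarrow>
     (\<exists>\<U>. countable \<U> \<and> (\<forall>U\<in>\<U>. open U \<and> closure U = UNIV) \<and> \<Inter>\<U> \<subseteq> R)"

definition transitive_point :: "('g \<Rightarrow> 'x::topological_space \<Rightarrow> 'x) \<Rightarrow> 'x \<Rightarrow> bool" where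
  "transitive_point T x \<longleftrightarrow> closure (range (\<lambda>i. T i x)) = UNIV"

definition transitive_TDS :: "('g \<Rightarrow> 'x::topological_space \<Rightarrow> 'x) \<Rightarrow> bool" where
  "transitive_TDS T \<longleftrightarrow> (\<exists>R. residual R \<and> (\<forall>x\<in>R. transitive_point T x))"

definition minimal_TDS :: "('g \<Rightarrow> 'x::topological_space \<Rightarrow> 'x) \<Rightarrow> bool" where
  "minimal_TDS T \<longleftrightarrow> (\<forall>x. transitive_point T x)"


section \<open>Mean equicontinuity and mean sensitivity\<close>

text \<open>The upper limit is taken in the extended reals; it is finite whenever \<open>f\<close> is bounded.\<close>

definition mean_dist ::
  "'g measure \<Rightarrow> (nat \<Rightarrow> 'g set) \<Rightarrow> ('g \<Rightarrow> 'x \<Rightarrow> 'x) \<Rightarrow> ('x \<Rightarrow> complex) \<Rightarrow> 'x \<Rightarrow> 'x \<Rightarrow> ereal" where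
  "mean_dist \<nu> F T f x y =
     limsup (\<lambda>n. ereal (sqrt (set_average \<nu> (F n) (\<lambda>j. (cmod (f (T j x) - f (T j y)))\<^sup>2))))"

definition mean_sensitive ::
  "'g measure \<Rightarrow> (nat \<Rightarrow> 'g set) \<Rightarrow> ('g \<Rightarrow> 'x::metric_space \<Rightarrow> 'x) \<Rightarrow> ('x \<Rightarrow> complex) \<Rightarrow> bool" where
  "mean_sensitive \<nu> F T f \<longleftrightarrow>
     (\<exists>\<epsilon>::real. \<epsilon> > 0 \<and>
        (\<forall>U. open U \<and> U \<noteq> {} \<longrightarrow> (\<exists>x\<in>U. \<exists>y\<in>U. mean_dist \<nu> F T f x y > ereal \<epsilon>)))"

definition mean_equicontinuity_point ::
  "'g measure \<Rightarrow> (nat \<Rightarrow> 'g set) \<Rightarrow> ('g \<Rightarrow> 'x::metric_space \<Rightarrow> 'x) \<Rightarrow> ('x \<Rightarrow> complex) \<Rightarrow> 'x \<Rightarrow> bool" where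
  "mean_equicontinuity_point \<nu> F T f x \<longleftrightarrow>
     (\<forall>\<epsilon>::real. \<epsilon> > 0 \<longrightarrow>
        (\<exists>\<delta>>0. \<forall>y. dist x y \<le> \<delta> \<longrightarrow> mean_dist \<nu> F T f x y \<le> ereal \<epsilon>))"

definition mean_equicontinuous ::
  "'g measure \<Rightarrow> (nat \<Rightarrow> 'g set) \<Rightarrow> ('g \<Rightarrow> 'x::metric_space \<Rightarrow> 'x) \<Rightarrow> ('x \<Rightarrow> complex) \<Rightarrow> bool" where
  "mean_equicontinuous \<nu> F T f \<longleftrightarrow> (\<forall>x. mean_equicontinuity_point \<nu> F T f x)"

definition almost_mean_equicontinuous ::
  "'g measure \<Rightarrow> (nat \<Rightarrow> 'g set) \<Rightarrow> ('g \<Rightarrow> 'x::metric_space \<Rightarrow> 'x) \<Rightarrow> ('x \<Rightarrow> complex) \<Rightarrow> bool" where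
  "almost_mean_equicontinuous \<nu> F T f \<longleftrightarrow> residual {x. mean_equicontinuity_point \<nu> F T f x}"

end

theory Submission
  imports Defs
begin

text \<open>
  The pseudometric \<open>d\<^sub>f\<close> satisfies a triangle inequality up to a constant, and the Folner condition
  makes it invariant under the action. Hence the set of points having a neighbourhood of
  \<open>d\<^sub>f\<close>-diameter at most \<open>\<epsilon>\<close> is open and invariant. If the system is not sensitive, this set is
  nonempty for every \<open>\<epsilon>\<close>, so it meets, and therefore contains, the orbit of every transitive
  point: all transitive points are equicontinuity points. Conversely, a single
  equicontinuity point, which the Baire category theorem provides, excludes sensitivity.
\<close>

section \<open>Integrals of bounded functions over sets of finite measure\<close>

lemma set_integrable_bounded:
  fixes \<phi> :: "'a \<Rightarrow> 'b::{banach, second_countable_topology}"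
  assumes "A \<in> sets M" "emeasure M A < \<infinity>" "\<phi> \<in> borel_measurable M" "\<And>j. norm (\<phi> j) \<le> B"
  shows "set_integrable M A \<phi>"
  unfolding set_integrable_def
  by (rule integrableI_bounded_set_indicator[where B = B]) (use assms in auto)

text \<open>On \<open>A \<inter> B\<close> the two integrands cancel and outside
  \<open>A \<union> B\<close> both vanish. On the symmetric difference exactly one of them survives,
  with norm at most \<open>C\<close>.\<close>

lemma norm_set_integral_diff_le:
  fixes \<phi> :: "'a \<Rightarrow> 'b::{banach, second_countable_topology}"
  assumes A: "A \<in> sets M" "emeasure M A < \<infinity>" and B: "B \<in> sets M" "emeasure M B < \<infinity>"
    and \<phi>: "\<phi> \<in> borel_measurable M" "\<And>j. norm (\<phi> j) \<le> C"
  shows "norm ((LINT j:A|M. \<phi> j) - (LINT j:B|M. \<phi> j)) \<le> C * measure M (sym_diff A B)"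
proof -
  have D: "sym_diff A B \<in> sets M"
    using A B by auto
  have "emeasure M (sym_diff A B) \<le> emeasure M (A \<union> B)"
    using A B by (intro emeasure_mono) auto
  also have "\<dots> \<le> emeasure M A + emeasure M B"
    using A B by (intro emeasure_subadditive) auto
  also have "\<dots> < \<infinity>"
    using A B by simp
  finally have Dfin: "emeasure M (sym_diff A B) < \<infinity>" .
  have int: "integrable M (\<lambda>j. indicator A j *\<^sub>R \<phi> j)" "integrable M (\<lambda>j. indicator B j *\<^sub>R \<phi> j)"
    using set_integrable_bounded[OF A \<phi>] set_integrable_bounded[OF B \<phi>]
    by (simp_all add: set_integrable_def)
  have "norm ((LINT j:A|M. \<phi> j) - (LINT j:B|M. \<phi> j))
      = norm (LINT j|M. indicator A j *\<^sub>R \<phi> j - indicator B j *\<^sub>R \<phi> j)"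
    using int by (simp add: set_lebesgue_integral_def)
  also have "\<dots> \<le> (LINT j|M. norm (indicator A j *\<^sub>R \<phi> j - indicator B j *\<^sub>R \<phi> j))"
    by (rule integral_norm_bound)
  also have "\<dots> \<le> (LINT j|M. C * indicator (sym_diff A B) j)"
  proof (rule integral_mono)
    show "integrable M (\<lambda>j. norm (indicator A j *\<^sub>R \<phi> j - indicator B j *\<^sub>R \<phi> j))"
      using int by (intro integrable_norm Bochner_Integration.integrable_diff)
    show "integrable M (\<lambda>j. C * indicator (sym_diff A B) j)"
      using D Dfin by (intro integrable_mult_right integrable_real_indicator)
    show "norm (indicator A j *\<^sub>R \<phi> j - indicator B j *\<^sub>R \<phi> j) \<le> C * indicator (sym_diff A B) j" for j
      using \<phi>(2)[of j] by (auto simp: indicator_def)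
  qed
  also have "\<dots> = C * measure M (sym_diff A B)"
    using sets.sets_into_space[OF D] by (simp add: Int_absorb2)
  finally show ?thesis .
qed

section \<open>Translation invariance of Haar measure and of integrals\<close>

lemma haar_measure_sets: "haar_measure \<nu> \<Longrightarrow> sets \<nu> = sets borel"
  unfolding haar_measure_def by (elim conjE)

lemma haar_measure_emeasure_add:
  "haar_measure \<nu> \<Longrightarrow> A \<in> sets \<nu> \<Longrightarrow> emeasure \<nu> ((+) g ` A) = emeasure \<nu> A"
  unfolding haar_measure_def by (elim conjE, drule spec[of _ g], drule bspec)

lemma haar_measure_space: "haar_measure \<nu> \<Longrightarrow> space \<nu> = UNIV"
  using sets_eq_imp_space_eq[OF haar_measure_sets] by simp

lemma haar_measure_measurable_iff:
  assumes "haar_measure \<nu>"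
  shows "\<phi> \<in> borel_measurable \<nu> \<longleftrightarrow> \<phi> \<in> borel_measurable borel"
  by (simp only: measurable_cong_sets[OF haar_measure_sets[OF assms] refl])

text \<open>Translation by \<open>g\<close> is inverted by translation by \<open>- g\<close>. This
  converts between images, in which invariance of \<open>\<nu>\<close> is stated, and preimages, in
  which measurability and push-forwards are stated.\<close>

lemma vimage_add_eq_image: "(+) g -` A = (+) (- g) ` (A :: 'g::ab_group_add set)"
proof (intro set_eqI iffI)
  fix x assume "x \<in> (+) g -` A"
  then show "x \<in> (+) (- g) ` A"
    by (intro image_eqI[of _ _ "g + x"]) auto
qed auto

lemma haar_measure_measurable_add:
  assumes "haar_measure \<nu>"
  shows "(+) g \<in> measurable \<nu> \<nu>"
proof -
  have "continuous_on UNIV ((+) g)"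
    by (rule continuous_on_add[OF continuous_on_const continuous_on_id])
  then have "(+) g \<in> borel_measurable borel"
    by (rule borel_measurable_continuous_onI)
  then show ?thesis
    by (simp only: measurable_cong_sets[OF haar_measure_sets[OF assms] haar_measure_sets[OF assms]])
qed

text \<open>Invariance is recast as a push-forward identity so that \<open>integral_distr\<close>
  yields the change of variables.\<close>

lemma haar_measure_distr_add:
  assumes "haar_measure \<nu>"
  shows "distr \<nu> \<nu> ((+) g) = \<nu>"
proof (rule measure_eqI)
  fix A assume "A \<in> sets (distr \<nu> \<nu> ((+) g))"
  then have A: "A \<in> sets \<nu>"
    by simp
  have "emeasure (distr \<nu> \<nu> ((+) g)) A = emeasure \<nu> ((+) g -` A \<inter> space \<nu>)"
    by (rule emeasure_distr[OF haar_measure_measurable_add[OF assms] A])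
  also have "\<dots> = emeasure \<nu> ((+) (- g) ` A)"
    by (simp only: haar_measure_space[OF assms] vimage_add_eq_image Int_UNIV_right)
  also have "\<dots> = emeasure \<nu> A"
    by (rule haar_measure_emeasure_add[OF assms A])
  finally show "emeasure (distr \<nu> \<nu> ((+) g)) A = emeasure \<nu> A" .
qed simp

lemma haar_measure_image_add_sets:
  assumes "haar_measure \<nu>" "A \<in> sets \<nu>"
  shows "(+) g ` A \<in> sets \<nu>"
  \<comment> \<open>The image under translation by \<open>g\<close> is the preimage under
    translation by \<open>- g\<close>.\<close>
  using measurable_sets[OF haar_measure_measurable_add[OF assms(1)] assms(2), of "- g"]
  unfolding haar_measure_space[OF assms(1)] vimage_add_eq_image minus_minus Int_UNIV_right .

text \<open>Substitute \<open>g + j\<close> for \<open>j\<close>. Since translation is injective,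
  \<open>g + j\<close> lies in the translate of \<open>A\<close> exactly when \<open>j\<close> lies
  in \<open>A\<close>.\<close>

lemma haar_measure_set_integral_translate:
  fixes \<phi> :: "'g::{topological_ab_group_add, t2_space} \<Rightarrow> 'b::{banach, second_countable_topology}"
  assumes \<nu>: "haar_measure \<nu>" and A: "A \<in> sets \<nu>" and \<phi>: "\<phi> \<in> borel_measurable \<nu>"
  shows "(LINT j:A|\<nu>. \<phi> (g + j)) = (LINT j:(+) g ` A|\<nu>. \<phi> j)"
proof -
  have "(LINT j:(+) g ` A|\<nu>. \<phi> j)
      = (LINT j|distr \<nu> \<nu> ((+) g). indicator ((+) g ` A) j *\<^sub>R \<phi> j)"
    unfolding haar_measure_distr_add[OF \<nu>] set_lebesgue_integral_def ..
  also have "\<dots> = (LINT j|\<nu>. indicator ((+) g ` A) (g + j) *\<^sub>R \<phi> (g + j))"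
    by (rule integral_distr[OF haar_measure_measurable_add[OF \<nu>]],
        rule borel_measurable_scaleR[OF borel_measurable_indicator \<phi>],
        rule haar_measure_image_add_sets[OF \<nu> A])
  also have "\<dots> = (LINT j:A|\<nu>. \<phi> (g + j))"
    by (simp only: set_lebesgue_integral_def indicator_def inj_image_mem_iff[OF inj_on_add])
  finally show ?thesis by simp
qed

section \<open>Averages and their asymptotic invariance along a Folner sequence\<close>

lemma folner_sequenceD:
  assumes "folner_sequence \<nu> F"
  shows "F n \<in> sets \<nu>" "emeasure \<nu> (F n) < \<infinity>"
    "(\<lambda>n. measure \<nu> (sym_diff ((+) g ` F n) (F n)) / measure \<nu> (F n)) \<longlonglongrightarrow> 0"
  using assms unfolding folner_sequence_def by blast+

lemma TDSD:
  fixes T :: "'g::{topological_ab_group_add, t2_space} \<Rightarrow> 'x::metric_space \<Rightarrow> 'x"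
  assumes "TDS T"
  shows "compact (UNIV :: 'x set)" "T (i + j) x = T i (T j x)"
    "(\<lambda>(j, x). T j x) \<in> borel_measurable borel" "continuous_on UNIV (T j)"
  using assms unfolding TDS_def by blast+

text \<open>Shifting the integrand amounts to shifting the set \<open>F n\<close>. The error is
  therefore at most \<open>C\<close> times the relative measure of the symmetric difference, which
  the Folner condition sends to 0.\<close>

lemma folner_set_average_translate:
  fixes \<phi> :: "'g::{topological_ab_group_add, t2_space} \<Rightarrow> 'b::{banach, second_countable_topology}"
  assumes \<nu>: "haar_measure \<nu>" and F: "folner_sequence \<nu> F"
    and \<phi>: "\<phi> \<in> borel_measurable \<nu>" "\<And>j. norm (\<phi> j) \<le> C"
  shows "(\<lambda>n. set_average \<nu> (F n) (\<lambda>j. \<phi> (g + j)) - set_average \<nu> (F n) \<phi>) \<longlonglongrightarrow> 0"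
proof (rule Lim_null_comparison)
  show "(\<lambda>n. C * (measure \<nu> (sym_diff ((+) g ` F n) (F n)) / measure \<nu> (F n))) \<longlonglongrightarrow> 0"
    by (rule tendsto_mult_right_zero) (rule folner_sequenceD[OF F])
  show "\<forall>\<^sub>F n in sequentially.
      norm (set_average \<nu> (F n) (\<lambda>j. \<phi> (g + j)) - set_average \<nu> (F n) \<phi>)
      \<le> C * (measure \<nu> (sym_diff ((+) g ` F n) (F n)) / measure \<nu> (F n))"
  proof (rule always_eventually, rule allI)
    fix n
    have Fn: "F n \<in> sets \<nu>" "emeasure \<nu> (F n) < \<infinity>"
      using folner_sequenceD[OF F] by blast+
    have gFn: "(+) g ` F n \<in> sets \<nu>" "emeasure \<nu> ((+) g ` F n) < \<infinity>"
      using haar_measure_image_add_sets[OF \<nu>] haar_measure_emeasure_add[OF \<nu>] Fn by simp_all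
    have "norm (set_average \<nu> (F n) (\<lambda>j. \<phi> (g + j)) - set_average \<nu> (F n) \<phi>)
        = norm ((LINT j:(+) g ` F n|\<nu>. \<phi> j) - (LINT j:F n|\<nu>. \<phi> j)) / measure \<nu> (F n)"
      by (simp add: set_average_def haar_measure_set_integral_translate[OF \<nu> Fn(1) \<phi>(1)]
          flip: scaleR_diff_right) (simp add: divide_inverse)
    also have "\<dots> \<le> C * measure \<nu> (sym_diff ((+) g ` F n) (F n)) / measure \<nu> (F n)"
      by (intro divide_right_mono norm_set_integral_diff_le[OF gFn Fn \<phi>]) simp
    finally show "norm (set_average \<nu> (F n) (\<lambda>j. \<phi> (g + j)) - set_average \<nu> (F n) \<phi>)
        \<le> C * (measure \<nu> (sym_diff ((+) g ` F n) (F n)) / measure \<nu> (F n))"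
      by simp
  qed
qed

lemma set_average_mono:
  fixes \<phi> \<psi> :: "'g \<Rightarrow> real"
  assumes "set_integrable \<nu> A \<phi>" "set_integrable \<nu> A \<psi>" "\<And>j. \<phi> j \<le> \<psi> j"
  shows "set_average \<nu> A \<phi> \<le> set_average \<nu> A \<psi>"
  unfolding set_average_def using assms by (intro scaleR_left_mono set_integral_mono) auto

section \<open>Square roots and upper limits of real sequences\<close>

text \<open>Subadditivity of the square root applied to
  \<open>u \<le> \<bar>u - v\<bar> + v\<close>. It carries a vanishing difference of averages over
  to their square roots.\<close>

lemma abs_sqrt_diff_le:
  fixes a b :: real
  assumes "0 \<le> a" "0 \<le> b"
  shows "\<bar>sqrt a - sqrt b\<bar> \<le> sqrt \<bar>a - b\<bar>"
proof -
  have *: "sqrt u - sqrt v \<le> sqrt \<bar>u - v\<bar>" if "0 \<le> u" "0 \<le> v" for u v :: real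
    using sqrt_add_le_add_sqrt[of "\<bar>u - v\<bar>" v] real_sqrt_le_mono[of u "\<bar>u - v\<bar> + v"] that by linarith
  show ?thesis
    using *[OF assms] *[OF assms(2,1)] by (simp add: abs_le_iff abs_minus_commute)
qed

text \<open>Write \<open>a n\<close> as \<open>(a n - b n) + b n\<close>; a summand with finite
  limit splits off from an upper limit.\<close>

lemma limsup_ereal_eq_of_diff_tendsto_zero:
  fixes a b :: "nat \<Rightarrow> real"
  assumes "(\<lambda>n. a n - b n) \<longlonglongrightarrow> 0"
  shows "limsup (\<lambda>n. ereal (a n)) = limsup (\<lambda>n. ereal (b n))"
proof -
  have "(\<lambda>n. ereal (a n - b n)) \<longlonglongrightarrow> 0"
    using assms by (simp add: zero_ereal_def)
  from ereal_limsup_lim_add[OF this, of "\<lambda>n. ereal (b n)"] show ?thesis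
    by simp
qed

section \<open>The pseudometric \<open>mean_dist\<close>\<close>

text \<open>Joint measurability refers to the Borel sets of the product topology, so the slice map
  sending \<open>j\<close> to \<open>(j, x)\<close> is measurable because it is continuous.\<close>

lemma TDS_orbit_measurable:
  assumes "TDS T" "continuous_on UNIV f"
  shows "(\<lambda>j. f (T j x)) \<in> borel_measurable borel"
proof -
  have "(\<lambda>j. (j, x)) \<in> borel_measurable borel"
    by (intro borel_measurable_continuous_onI continuous_intros)
  from measurable_compose[OF this TDSD(3)[OF assms(1)]]
  have "(\<lambda>j. T j x) \<in> borel_measurable borel"
    by simp
  then show ?thesis
    by (rule measurable_compose) (rule borel_measurable_continuous_onI[OF assms(2)])
qed

text \<open>Compactness bounds \<open>f\<close> by some \<open>B\<close>, and \<open>C\<close> is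
  \<open>(2 * B)\<^sup>2\<close>. One constant serves all pairs of points and all times.\<close>

lemma mean_dist_integrand:
  fixes T :: "'g::{topological_ab_group_add, t2_space} \<Rightarrow> 'x::metric_space \<Rightarrow> 'x"
    and f :: "'x \<Rightarrow> complex"
  assumes \<nu>: "haar_measure \<nu>" and T: "TDS T" and f: "continuous_on UNIV f"
  obtains C where "\<And>x y. (\<lambda>j. (cmod (f (T j x) - f (T j y)))\<^sup>2) \<in> borel_measurable \<nu>"
    and "\<And>x y j. norm ((cmod (f (T j x) - f (T j y)))\<^sup>2) \<le> C"
proof -
  have "compact (range f)"
    by (rule compact_continuous_image[OF f TDSD(1)[OF T]])
  then obtain B where B: "\<And>x. norm (f x) \<le> B"
    using compact_imp_bounded bounded_iff by (metis rangeI)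
  have "cmod (f (T j x) - f (T j y)) \<le> 2 * B" for x y j
    using norm_triangle_ineq4[of "f (T j x)" "f (T j y)"] B[of "T j x"] B[of "T j y"] by linarith
  then have "norm ((cmod (f (T j x) - f (T j y)))\<^sup>2) \<le> (2 * B)\<^sup>2" for x y j
    using power_mono[of "cmod (f (T j x) - f (T j y))" "2 * B" 2] by simp
  moreover have "(\<lambda>j. (cmod (f (T j x) - f (T j y)))\<^sup>2) \<in> borel_measurable \<nu>" for x y
    unfolding haar_measure_measurable_iff[OF \<nu>]
    using TDS_orbit_measurable[OF T f, of x] TDS_orbit_measurable[OF T f, of y] by measurable
  ultimately show thesis
    using that by blast
qed

lemma set_average_nonneg: "(\<And>j. 0 \<le> \<phi> j) \<Longrightarrow> 0 \<le> set_average \<nu> A (\<phi> :: 'g \<Rightarrow> real)"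
  unfolding set_average_def set_lebesgue_integral_def
  by (intro scaleR_nonneg_nonneg Bochner_Integration.integral_nonneg) auto

text \<open>Moving both points by \<open>T g\<close> translates the integrand by \<open>g\<close>,
  which changes the averages only by a null sequence.\<close>

lemma mean_dist_invariant:
  fixes T :: "'g::{topological_ab_group_add, t2_space} \<Rightarrow> 'x::metric_space \<Rightarrow> 'x"
  assumes \<nu>: "haar_measure \<nu>" and F: "folner_sequence \<nu> F"
    and T: "TDS T" and f: "continuous_on UNIV f"
  shows "mean_dist \<nu> F T f (T g x) (T g y) = mean_dist \<nu> F T f x y"
proof -
  define \<phi> where "\<phi> = (\<lambda>j. (cmod (f (T j x) - f (T j y)))\<^sup>2)"
  obtain C where \<phi>: "\<phi> \<in> borel_measurable \<nu>" "\<And>j. norm (\<phi> j) \<le> C"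
    unfolding \<phi>_def using mean_dist_integrand[OF \<nu> T f] by metis
  \<comment> \<open>The action law gives \<open>T (j + g) z\<close>; commutativity of the group puts
    \<open>g\<close> on the left, as the translation lemma expects.\<close>
  have "T j (T g z) = T (g + j) z" for j z
    using TDSD(2)[OF T, of j g z] by (simp add: add.commute)
  then have shift: "(cmod (f (T j (T g x)) - f (T j (T g y))))\<^sup>2 = \<phi> (g + j)" for j
    by (simp add: \<phi>_def)
  define a where "a n = set_average \<nu> (F n) (\<lambda>j. \<phi> (g + j))" for n
  define b where "b n = set_average \<nu> (F n) \<phi>" for n
  have nonneg: "0 \<le> a n" "0 \<le> b n" for n
    unfolding a_def b_def by (auto intro!: set_average_nonneg simp: \<phi>_def)
  have "(\<lambda>n. a n - b n) \<longlonglongrightarrow> 0"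
    unfolding a_def b_def by (rule folner_set_average_translate[OF \<nu> F \<phi>])
  then have lim: "(\<lambda>n. sqrt \<bar>a n - b n\<bar>) \<longlonglongrightarrow> 0"
    using tendsto_real_sqrt[OF tendsto_rabs_zero] by fastforce
  have "(\<lambda>n. sqrt (a n) - sqrt (b n)) \<longlonglongrightarrow> 0"
    by (rule Lim_null_comparison[OF _ lim]) (simp add: abs_sqrt_diff_le nonneg)
  then show ?thesis
    unfolding mean_dist_def shift
    by (simp add: limsup_ereal_eq_of_diff_tendsto_zero flip: a_def b_def \<phi>_def)
qed

text \<open>The pointwise bound \<open>(a + b)\<^sup>2 \<le> 2 * a\<^sup>2 + 2 * b\<^sup>2\<close>
  replaces the Minkowski inequality, at the price of the constant 4. Both hypotheses have the centre
  \<open>x\<close> first, matching the definition of an equicontinuity point.\<close>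

lemma mean_dist_quasi_triangle:
  fixes T :: "'g::{topological_ab_group_add, t2_space} \<Rightarrow> 'x::metric_space \<Rightarrow> 'x"
  assumes \<nu>: "haar_measure \<nu>" and F: "folner_sequence \<nu> F"
    and T: "TDS T" and f: "continuous_on UNIV f" and "\<epsilon> > 0"
    and xy: "mean_dist \<nu> F T f x y \<le> ereal \<epsilon>" and xz: "mean_dist \<nu> F T f x z \<le> ereal \<epsilon>"
  shows "mean_dist \<nu> F T f y z \<le> ereal (4 * \<epsilon>)"
proof -
  define q where "q u v j = (cmod (f (T j u) - f (T j v)))\<^sup>2" for u v j
  obtain C where q: "\<And>u v. q u v \<in> borel_measurable \<nu>" "\<And>u v j. norm (q u v j) \<le> C"
    unfolding q_def using mean_dist_integrand[OF \<nu> T f] by metis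
  have dist_eq: "mean_dist \<nu> F T f u v = limsup (\<lambda>n. ereal (sqrt (set_average \<nu> (F n) (q u v))))" for u v
    by (simp add: mean_dist_def q_def[abs_def])
  have int: "set_integrable \<nu> (F n) (q u v)" for u v n
    by (rule set_integrable_bounded[OF folner_sequenceD(1,2)[OF F] q])
  have "q y z j \<le> 2 * q x y j + 2 * q x z j" for j
  proof -
    \<comment> \<open>The difference on the left equals the second difference on the right minus the
      first.\<close>
    have "cmod (f (T j y) - f (T j z)) \<le> cmod (f (T j x) - f (T j y)) + cmod (f (T j x) - f (T j z))"
      using norm_triangle_ineq4[of "f (T j x) - f (T j z)" "f (T j x) - f (T j y)"] by simp
    then have "q y z j \<le> (cmod (f (T j x) - f (T j y)) + cmod (f (T j x) - f (T j z)))\<^sup>2"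
      unfolding q_def by (intro power_mono) auto
    also have "\<dots> \<le> 2 * q x y j + 2 * q x z j"
      unfolding q_def
      using sum_squares_bound[of "cmod (f (T j x) - f (T j y))" "cmod (f (T j x) - f (T j z))"]
      by (simp add: power2_sum)
    finally show ?thesis .
  qed
  then have avg: "set_average \<nu> (F n) (q y z)
      \<le> 2 * set_average \<nu> (F n) (q x y) + 2 * set_average \<nu> (F n) (q x z)" for n
    using set_average_mono[OF int, of n "\<lambda>j. 2 * q x y j + 2 * q x z j" y z] int
    by (simp add: set_average_def algebra_simps)
  \<comment> \<open>An upper limit equal to \<open>\<epsilon>\<close> does not force the terms below
    \<open>\<epsilon>\<close>; doubling leaves room for a strict eventual bound.\<close>
  have small: "\<forall>\<^sub>F n in sequentially. sqrt (set_average \<nu> (F n) (q u v)) < 2 * \<epsilon>"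
    if "mean_dist \<nu> F T f u v \<le> ereal \<epsilon>" for u v
  proof -
    have "limsup (\<lambda>n. ereal (sqrt (set_average \<nu> (F n) (q u v)))) < ereal (2 * \<epsilon>)"
      using that \<open>\<epsilon> > 0\<close> order_le_less_trans[of _ "ereal \<epsilon>" "ereal (2 * \<epsilon>)"]
      unfolding dist_eq by simp
    from Limsup_lessD[OF this] show ?thesis by simp
  qed
  have "\<forall>\<^sub>F n in sequentially. ereal (sqrt (set_average \<nu> (F n) (q y z))) \<le> ereal (4 * \<epsilon>)"
    using small[OF xy] small[OF xz]
  proof eventually_elim
    case (elim n)
    have sq: "set_average \<nu> (F n) (q u v) \<le> (2 * \<epsilon>)\<^sup>2"
      if "sqrt (set_average \<nu> (F n) (q u v)) < 2 * \<epsilon>" for u v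
      using that by (intro sqrt_le_D less_imp_le)
    \<comment> \<open>Here \<open>2 * (2 * \<epsilon>)\<^sup>2 + 2 * (2 * \<epsilon>)\<^sup>2 = (4 *
      \<epsilon>)\<^sup>2\<close>.\<close>
    have "set_average \<nu> (F n) (q y z) \<le> (4 * \<epsilon>)\<^sup>2"
      using avg[of n] sq[OF elim(1)] sq[OF elim(2)] by (simp add: power2_eq_square)
    then show ?case
      using \<open>\<epsilon> > 0\<close> by (simp add: real_le_lsqrt)
  qed
  then show ?thesis
    unfolding dist_eq by (rule Limsup_bounded)
qed

section \<open>Equicontinuity points versus sensitivity\<close>

text \<open>By the quasi-triangle inequality a small ball around \<open>x\<close> has
  \<open>mean_dist\<close>-diameter at most the supposed sensitivity constant.\<close>

lemma mean_equicontinuity_point_not_sensitive: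
  fixes T :: "'g::{topological_ab_group_add, t2_space} \<Rightarrow> 'x::metric_space \<Rightarrow> 'x"
  assumes "haar_measure \<nu>" "folner_sequence \<nu> F" "TDS T" "continuous_on UNIV f"
    and x: "mean_equicontinuity_point \<nu> F T f x"
  shows "\<not> mean_sensitive \<nu> F T f"
proof
  assume "mean_sensitive \<nu> F T f"
  then obtain \<epsilon> :: real where "\<epsilon> > 0"
    and \<epsilon>: "\<And>U. open U \<Longrightarrow> U \<noteq> {} \<Longrightarrow> \<exists>y\<in>U. \<exists>z\<in>U. mean_dist \<nu> F T f y z > ereal \<epsilon>"
    unfolding mean_sensitive_def by blast
  \<comment> \<open>The quarter compensates the factor 4 of
    \<open>mean_dist_quasi_triangle\<close>.\<close>
  from x \<open>\<epsilon> > 0\<close> obtain \<delta> where "\<delta> > 0"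
    and \<delta>: "\<And>y. dist x y \<le> \<delta> \<Longrightarrow> mean_dist \<nu> F T f x y \<le> ereal (\<epsilon> / 4)"
    unfolding mean_equicontinuity_point_def
    by (metis divide_pos_pos zero_less_numeral)
  from \<epsilon>[of "ball x \<delta>"] \<open>\<delta> > 0\<close> obtain y z
    where "y \<in> ball x \<delta>" "z \<in> ball x \<delta>" "mean_dist \<nu> F T f y z > ereal \<epsilon>"
    by auto
  moreover from this have "mean_dist \<nu> F T f y z \<le> ereal (4 * (\<epsilon> / 4))"
    using assms(1-4) \<delta> \<open>\<epsilon> > 0\<close> by (intro mean_dist_quasi_triangle[of \<nu> F T f _ x]) auto
  ultimately show False by simp
qed

text \<open>Failure of sensitivity gives, for each \<open>\<epsilon>\<close>, a nonempty open set of
  \<open>mean_dist\<close>-diameter at most \<open>\<epsilon>\<close>. The orbit of \<open>x\<close>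
  enters it at some \<open>T g x\<close>; pulling the set back along \<open>T g\<close> gives a
  neighbourhood of \<open>x\<close>, and invariance keeps the bound.\<close>

lemma transitive_point_mean_equicontinuity_point:
  fixes T :: "'g::{topological_ab_group_add, t2_space} \<Rightarrow> 'x::metric_space \<Rightarrow> 'x"
  assumes \<nu>: "haar_measure \<nu>" and F: "folner_sequence \<nu> F"
    and T: "TDS T" and f: "continuous_on UNIV f"
    and not_sens: "\<not> mean_sensitive \<nu> F T f" and x: "transitive_point T x"
  shows "mean_equicontinuity_point \<nu> F T f x"
  unfolding mean_equicontinuity_point_def
proof (intro allI impI)
  fix \<epsilon> :: real assume "\<epsilon> > 0"
  with not_sens obtain U where U: "open U" "U \<noteq> {}"
    and small: "\<And>y z. y \<in> U \<Longrightarrow> z \<in> U \<Longrightarrow> mean_dist \<nu> F T f y z \<le> ereal \<epsilon>"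
    unfolding mean_sensitive_def by (meson not_less)
  have "U \<inter> range (\<lambda>i. T i x) \<noteq> {}"
    using U x open_Int_closure_eq_empty[OF U(1)] by (fastforce simp: transitive_point_def)
  then obtain g where g: "T g x \<in> U" by auto
  have "open (T g -` U)"
    by (rule open_vimage[OF U(1) TDSD(4)[OF T]])
  \<comment> \<open>A closed ball fits the non-strict \<open>dist x y \<le> \<delta>\<close> of the
    definition.\<close>
  with g obtain \<delta> where "\<delta> > 0" and \<delta>: "cball x \<delta> \<subseteq> T g -` U"
    unfolding open_contains_cball by blast
  have "mean_dist \<nu> F T f x y \<le> ereal \<epsilon>" if "dist x y \<le> \<delta>" for y
    using small[OF g, of "T g y"] that \<delta> mean_dist_invariant[OF \<nu> F T f, of g x y]
    by (auto simp: subset_iff)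
  with \<open>\<delta> > 0\<close> show "\<exists>\<delta>>0. \<forall>y. dist x y \<le> \<delta> \<longrightarrow> mean_dist \<nu> F T f x y \<le> ereal \<epsilon>"
    by blast
qed

section \<open>Residual sets and the two dichotomies\<close>

lemma residual_mono: "residual R \<Longrightarrow> R \<subseteq> S \<Longrightarrow> residual S"
  unfolding residual_def by (meson subset_trans)

text \<open>Baire category in its locally compact regular form makes the countable intersection
  dense. A dense set is nonempty because the type \<open>'x\<close> is.\<close>

lemma residual_nonempty:
  fixes R :: "'x::metric_space set"
  assumes "compact (UNIV :: 'x set)" "residual R"
  shows "R \<noteq> {}"
proof -
  from assms(2) obtain \<U> :: "'x set set" where \<U>: "countable \<U>"
    "\<And>U. U \<in> \<U> \<Longrightarrow> open U \<and> closure U = UNIV" "\<Inter>\<U> \<subseteq> R"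
    unfolding residual_def by blast
  have "regular_space (euclidean :: 'x topology)"
    by (rule metrizable_imp_regular_space[OF metrizable_space_euclidean])
  then have "(euclidean :: 'x topology) closure_of \<Inter>\<U> = topspace euclidean"
    using \<U>(1,2) assms(1)
    by (intro Baire_category)
      (auto simp: compact_space_def intro!: compact_imp_locally_compact_space)
  then show ?thesis
    using \<U>(3) by auto
qed

theorem theorem2p13:
  fixes \<nu> :: "'g::{topological_ab_group_add, t2_space} measure"
    and F :: "nat \<Rightarrow> 'g set"
    and T :: "'g \<Rightarrow> 'x::metric_space \<Rightarrow> 'x"
    and f :: "'x \<Rightarrow> complex"
  assumes "locally_compact_space (euclidean :: 'g topology)"
    and "haar_measure \<nu>"
    and "folner_sequence \<nu> F"
    and "pointwise_ergodic_sequence \<nu> F"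
    and "TDS T"
    and "continuous_on UNIV f"
  shows "(transitive_TDS T \<longrightarrow>
            (almost_mean_equicontinuous \<nu> F T f \<or> mean_sensitive \<nu> F T f) \<and>
            \<not> (almost_mean_equicontinuous \<nu> F T f \<and> mean_sensitive \<nu> F T f)) \<and>
         (minimal_TDS T \<longrightarrow>
            (mean_equicontinuous \<nu> F T f \<or> mean_sensitive \<nu> F T f) \<and>
            \<not> (mean_equicontinuous \<nu> F T f \<and> mean_sensitive \<nu> F T f))"
proof -
  note transitive = transitive_point_mean_equicontinuity_point[OF assms(2,3,5,6)]
  note not_sens = mean_equicontinuity_point_not_sensitive[OF assms(2,3,5,6)]
  \<comment> \<open>The residual set of transitive points consists of equicontinuity points.\<close>
  have "almost_mean_equicontinuous \<nu> F T f" if "transitive_TDS T" "\<not> mean_sensitive \<nu> F T f"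
    using that transitive unfolding transitive_TDS_def almost_mean_equicontinuous_def
    by (metis residual_mono mem_Collect_eq subsetI)
  moreover have "\<not> mean_sensitive \<nu> F T f" if "almost_mean_equicontinuous \<nu> F T f"
    using residual_nonempty[of "{x. mean_equicontinuity_point \<nu> F T f x}"] that not_sens TDSD(1)[OF assms(5)]
    unfolding almost_mean_equicontinuous_def by blast
  moreover have "mean_equicontinuous \<nu> F T f" if "minimal_TDS T" "\<not> mean_sensitive \<nu> F T f"
    using that transitive unfolding minimal_TDS_def mean_equicontinuous_def by blast
  \<comment> \<open>One equicontinuity point suffices, and any element of the nonempty type
    \<open>'x\<close> provides it.\<close>
  moreover have "\<not> mean_sensitive \<nu> F T f" if "mean_equicontinuous \<nu> F T f"
    using that not_sens unfolding mean_equicontinuous_def by blast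
  ultimately show ?thesis by blast
qed

end
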